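(* Let $A\subset[N]^r$, let $d\ge1$ be an integer, and let $\Lambda$ be a nonempty finite index set. For each $\lambda\in\Lambda$ let $L_\lambda\le(\mathbb Z/d\mathbb Z)^r$ be an additive subgroup, and let $M_\lambda$ be the number of cosets of $L_\lambda$ in $(\mathbb Z/d\mathbb Z)^r$ that meet the image of $A$ modulo $d$. Assume that $M_\lambda\le M$ for every $\lambda\in\Lambda$. For $h\in\mathbb Z^r$ put $$W(h):=\#\{\lambda\in\Lambda: h\in L_\lambda\pmod d\}.$$ Let $\mathcal Y$ be a set, let $F:\mathbb Z^r\setminus\{0\}\to\mathcal Y$ be a function, and suppose that for every $y\in\mathcal Y$, $$R_F(y):=\#\{(a,b)\in A^2: a\ne b,\ F(a-b)=y\}\le B.$$ Suppose $v:\mathcal Y\to\mathbb R_{\ge0}$ satisfies $W(h)\le v(F(h))$ for every nonzero $h\in A-A$, and set $$U:=\sum_{y\in F((A-A)\setminus\{0\})}v(y).$$ If $|A|\ge2M$, then $$|A|^2\le\frac{2MBU}{|\Lambda|}.$$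
   Context: $N,r$ are positive integers and $[N]=\{1,\ldots,N\}$. $A-A=\{a-b:a,b\in A\}$. For $h\in\mathbb Z^r$, "$h\in L_\lambda\pmod d$" means that the reduction of $h$ modulo $d$ lies in $L_\lambda$ (equivalently $h\in L_\lambda+d\mathbb Z^r$). *)

theory Defs
  imports
    Complex_Main
    "HOL-Analysis.Finite_Cartesian_Product"
    "HOL-Algebra.Elementary_Groups"
    "HOL-Algebra.Product_Groups"
begin

text \<open>
  The lattice \<open>Z^r\<close> is \<open>int ^ 'r\<close> with \<open>r = CARD('r)\<close>.  The additive group \<open>(Z/dZ)^r\<close> is the
  library product of \<open>r\<close> copies of \<open>integer_mod_group d\<close>, whose carrier is \<open>{0..<d}\<close> with addition
  modulo \<open>d\<close>; as everywhere in HOL-Algebra, the group operation is written multiplicatively.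
  Note that \<open>integer_mod_group 0\<close> is the group of all integers, so \<open>d \<ge> 1\<close> is not automatic.
\<close>

definition int_cube :: "nat \<Rightarrow> (int ^ 'r) set" where
  "int_cube N = {x. \<forall>i. x $ i \<in> {1..int N}}"

definition difference_set :: "'a::minus set \<Rightarrow> 'a set" where
  "difference_set A = {a - b | a b. a \<in> A \<and> b \<in> A}"

definition residue_vec_group :: "nat \<Rightarrow> ('r::finite \<Rightarrow> int) monoid" where
  "residue_vec_group d = product_group UNIV (\<lambda>_. integer_mod_group d)"

definition reduce_mod :: "nat \<Rightarrow> int ^ 'r \<Rightarrow> ('r::finite \<Rightarrow> int)" where
  "reduce_mod d h = (\<lambda>i. (h $ i) mod int d)"

definition cosets_met :: "nat \<Rightarrow> ('r::finite \<Rightarrow> int) set \<Rightarrow> (int ^ 'r) set \<Rightarrow> ('r \<Rightarrow> int) set set" where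
  "cosets_met d L A = {C \<in> rcosets\<^bsub>residue_vec_group d\<^esub> L. C \<inter> reduce_mod d ` A \<noteq> {}}"

definition weight ::
    "nat \<Rightarrow> 'l set \<Rightarrow> ('l \<Rightarrow> ('r::finite \<Rightarrow> int) set) \<Rightarrow> int ^ 'r \<Rightarrow> nat" where
  "weight d \<Lambda> L h = card {l \<in> \<Lambda>. reduce_mod d h \<in> L l}"

definition rep_count :: "(int ^ 'r::finite) set \<Rightarrow> (int ^ 'r \<Rightarrow> 'y) \<Rightarrow> 'y \<Rightarrow> nat" where
  "rep_count A F y = card {(a, b). a \<in> A \<and> b \<in> A \<and> a \<noteq> b \<and> F (a - b) = y}"

end

theory Submission
  imports Defs "HOL-Analysis.Convex"
begin

text \<open>
  Fix \<open>\<lambda>\<close> and sort \<open>A\<close> into the cosets of \<open>L\<^sub>\<lambda>\<close>.  There are at most \<open>M\<close> nonempty classes, so by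
  Cauchy--Schwarz at least \<open>|A|\<^sup>2/M\<close> ordered pairs lie in a common class.  Of these, \<open>|A|\<close> are
  diagonal, and \<open>|A| \<ge> 2M\<close> says exactly that the diagonal is at most half of \<open>|A|\<^sup>2/M\<close>.  So at least
  \<open>|A|\<^sup>2/(2M)\<close> pairs with \<open>a \<noteq> b\<close> have \<open>a - b \<in> L\<^sub>\<lambda>\<close>
  (\<open>card_squared_le_off_diagonal_coset_pairs\<close>).

  Summing over \<open>\<lambda>\<close> counts each pair \<open>a \<noteq> b\<close> with multiplicity \<open>W(a - b) \<le> v(F(a - b))\<close>.  Sorting
  the pairs by the value \<open>y = F(a - b)\<close>, each \<open>v(y)\<close> is used at most \<open>B\<close> times, so the total is at
  most \<open>BU\<close>.  Hence \<open>|\<Lambda>| |A|\<^sup>2/(2M) \<le> BU\<close>.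
\<close>

section \<open>Pairs on which a map with few values collides\<close>

text \<open>
  Cauchy--Schwarz on the fibre sizes: they sum to \<open>card A\<close>, while their squares sum to the number
  of colliding pairs.
\<close>
lemma card_squared_le_card_image_times_collisions:
  assumes "finite A"
  shows "(real (card A))\<^sup>2
           \<le> real (card (g ` A)) * real (card {(a, b). a \<in> A \<and> b \<in> A \<and> g a = g b})"
proof -
  define fibre where "fibre c = {a \<in> A. g a = c}" for c
  have fin: "finite (fibre c)" for c
    using assms by (simp add: fibre_def)
  have sum: "card A = (\<Sum>c\<in>g ` A. card (fibre c))"
    using sum.image_gen[OF assms, of "\<lambda>_. 1::nat" g] by (simp add: fibre_def)
  have "{(a, b). a \<in> A \<and> b \<in> A \<and> g a = g b} = (\<Union>c\<in>g ` A. fibre c \<times> fibre c)"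
    by (auto simp: fibre_def)
  also have "card \<dots> = (\<Sum>c\<in>g ` A. card (fibre c \<times> fibre c))"
    using assms fin by (intro card_UN_disjoint) (auto simp: fibre_def)
  finally have collisions:
    "real (card {(a, b). a \<in> A \<and> b \<in> A \<and> g a = g b}) = (\<Sum>c\<in>g ` A. (real (card (fibre c)))\<^sup>2)"
    by (simp add: card_cartesian_product power2_eq_square)
  show ?thesis
    using sum_squared_le_sum_of_squares[of "\<lambda>c. real (card (fibre c))" "g ` A"]
    by (simp add: collisions sum mult.commute)
qed

lemma card_squared_le_off_diagonal_collisions:
  fixes M :: real
  assumes "finite A" and few: "real (card (g ` A)) \<le> M" and large: "real (card A) \<ge> 2 * M"
  shows "(real (card A))\<^sup>2
           \<le> 2 * M * real (card {(a, b). a \<in> A \<and> b \<in> A \<and> a \<noteq> b \<and> g a = g b})"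
proof -
  let ?n = "real (card A)"
  let ?Q = "{(a, b). a \<in> A \<and> b \<in> A \<and> g a = g b}"
  let ?P = "{(a, b). a \<in> A \<and> b \<in> A \<and> a \<noteq> b \<and> g a = g b}"
  have fin: "finite ?P"
    by (rule finite_subset[of _ "A \<times> A"]) (use \<open>finite A\<close> in auto)
  have "?Q = ?P \<union> (\<lambda>a. (a, a)) ` A"
    by auto
  also have "card \<dots> = card ?P + card ((\<lambda>a. (a, a)) ` A)"
    using \<open>finite A\<close> fin by (intro card_Un_disjoint) auto
  also have "card ((\<lambda>a. (a, a)) ` A) = card A"
    by (rule card_image) (simp add: inj_on_def)
  finally have Q: "real (card ?Q) = real (card ?P) + ?n"
    by simp
  have "?n\<^sup>2 \<le> real (card (g ` A)) * real (card ?Q)"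
    by (rule card_squared_le_card_image_times_collisions[OF \<open>finite A\<close>])
  also have "\<dots> \<le> M * (real (card ?P) + ?n)"
    unfolding Q by (rule mult_right_mono[OF few]) simp
  finally have "?n\<^sup>2 \<le> M * real (card ?P) + M * ?n"
    by (simp add: distrib_left)
  moreover have "2 * M * ?n \<le> ?n\<^sup>2"
    using mult_right_mono[OF large, of ?n] by (simp add: power2_eq_square)
  ultimately show ?thesis
    by linarith
qed

section \<open>Reduction modulo d and cosets\<close>

lemma group_residue_vec_group: "group (residue_vec_group d)"
  by (simp add: residue_vec_group_def)

text \<open>For \<open>d = 0\<close> the carrier consists of all integer vectors, so positivity is essential.\<close>
lemma finite_carrier_residue_vec_group:
  assumes "d \<ge> 1"
  shows "finite (carrier (residue_vec_group d :: ('r::finite \<Rightarrow> int) monoid))"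
  using assms by (auto simp: residue_vec_group_def carrier_integer_mod_group intro!: finite_PiE)

lemma reduce_mod_in_carrier:
  assumes "d \<ge> 1"
  shows "reduce_mod d h \<in> carrier (residue_vec_group d)"
  using assms by (auto simp: residue_vec_group_def reduce_mod_def carrier_integer_mod_group)

lemma reduce_mod_add:
  "reduce_mod d (g + h) = reduce_mod d g \<otimes>\<^bsub>residue_vec_group d\<^esub> reduce_mod d h"
  by (simp add: residue_vec_group_def reduce_mod_def mod_add_eq fun_eq_iff)

lemma reduce_mod_diff_in_subgroup:
  fixes a b :: "int ^ 'r::finite"
  assumes "d \<ge> 1" and sub: "subgroup H (residue_vec_group d)"
    and eq: "H #>\<^bsub>residue_vec_group d\<^esub> reduce_mod d a = H #>\<^bsub>residue_vec_group d\<^esub> reduce_mod d b"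
  shows "reduce_mod d (a - b) \<in> H"
proof -
  interpret group "residue_vec_group d :: ('r \<Rightarrow> int) monoid"
    by (rule group_residue_vec_group)
  note carr = reduce_mod_in_carrier[OF \<open>d \<ge> 1\<close>]
  have "reduce_mod d a \<in> H #>\<^bsub>residue_vec_group d\<^esub> reduce_mod d b"
    using rcos_self[OF carr sub] eq by metis
  then obtain x where x: "x \<in> H"
      and "reduce_mod d a = x \<otimes>\<^bsub>residue_vec_group d\<^esub> reduce_mod d b"
    by (auto simp: r_coset_def)
  then have "reduce_mod d (a - b) \<otimes>\<^bsub>residue_vec_group d\<^esub> reduce_mod d b
      = x \<otimes>\<^bsub>residue_vec_group d\<^esub> reduce_mod d b"
    by (simp flip: reduce_mod_add)
  then have "reduce_mod d (a - b) = x"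
    using carr subgroup.mem_carrier[OF sub x] by (meson right_cancel)
  with x show ?thesis
    by simp
qed

lemma card_coset_image_le_cosets_met:
  fixes A :: "(int ^ 'r::finite) set"
  assumes "d \<ge> 1" and sub: "subgroup H (residue_vec_group d)"
  shows "card ((\<lambda>a. H #>\<^bsub>residue_vec_group d\<^esub> reduce_mod d a) ` A) \<le> card (cosets_met d H A)"
proof (rule card_mono)
  interpret group "residue_vec_group d :: ('r \<Rightarrow> int) monoid"
    by (rule group_residue_vec_group)
  note carr = reduce_mod_in_carrier[OF \<open>d \<ge> 1\<close>]
  have "finite (rcosets\<^bsub>residue_vec_group d\<^esub> H)"
    using finite_carrier_residue_vec_group[OF \<open>d \<ge> 1\<close>] unfolding RCOSETS_def by auto
  then show "finite (cosets_met d H A)"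
    by (simp add: cosets_met_def)
  show "(\<lambda>a. H #>\<^bsub>residue_vec_group d\<^esub> reduce_mod d a) ` A \<subseteq> cosets_met d H A"
    using rcosetsI[OF subgroup.subset[OF sub] carr] rcos_self[OF carr sub]
    by (fastforce simp: cosets_met_def)
qed

text \<open>
  Points of \<open>A\<close> in the same coset differ by an element of the subgroup, so the off-diagonal
  collisions of the coset map are among the pairs counted here.
\<close>
lemma card_squared_le_off_diagonal_coset_pairs:
  fixes M :: real
  assumes "finite A" and "d \<ge> 1" and sub: "subgroup H (residue_vec_group d)"
    and few: "real (card (cosets_met d H A)) \<le> M" and large: "real (card A) \<ge> 2 * M"
  shows "(real (card A))\<^sup>2
           \<le> 2 * M * real (card {(a, b). a \<in> A \<and> b \<in> A \<and> a \<noteq> b \<and> reduce_mod d (a - b) \<in> H})"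
proof -
  let ?g = "\<lambda>a. H #>\<^bsub>residue_vec_group d\<^esub> reduce_mod d a"
  let ?P = "{(a, b). a \<in> A \<and> b \<in> A \<and> a \<noteq> b \<and> ?g a = ?g b}"
  let ?R = "{(a, b). a \<in> A \<and> b \<in> A \<and> a \<noteq> b \<and> reduce_mod d (a - b) \<in> H}"
  have "0 \<le> M"
    using few by linarith
  have "finite ?R"
    by (rule finite_subset[of _ "A \<times> A"]) (use \<open>finite A\<close> in auto)
  then have "card ?P \<le> card ?R"
    using reduce_mod_diff_in_subgroup[OF \<open>d \<ge> 1\<close> sub] by (intro card_mono) auto
  have "real (card (?g ` A)) \<le> M"
    using card_coset_image_le_cosets_met[OF \<open>d \<ge> 1\<close> sub, of A] few by linarith
  then have "(real (card A))\<^sup>2 \<le> 2 * M * real (card ?P)"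
    by (rule card_squared_le_off_diagonal_collisions[OF \<open>finite A\<close> _ large])
  also have "\<dots> \<le> 2 * M * real (card ?R)"
    using \<open>card ?P \<le> card ?R\<close> \<open>0 \<le> M\<close> by (intro mult_left_mono) auto
  finally show ?thesis .
qed

section \<open>Double counting of differences\<close>

lemma finite_int_cube: "finite (int_cube N :: (int ^ 'r::finite) set)"
proof (rule finite_imageD)
  show "finite (vec_nth ` (int_cube N :: (int ^ 'r) set))"
    by (rule finite_subset[of _ "PiE UNIV (\<lambda>_. {1..int N})"])
      (auto simp: int_cube_def intro!: finite_PiE)
  show "inj_on vec_nth (int_cube N :: (int ^ 'r) set)"
    by (simp add: inj_on_def vec_nth_inject)
qed

lemma difference_in_difference_set: "a \<in> A \<Longrightarrow> b \<in> A \<Longrightarrow> a - b \<in> difference_set A"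
  unfolding difference_set_def by blast

lemma sum_card_coset_pairs_eq_sum_weight:
  assumes "finite A" and "finite \<Lambda>"
  shows "(\<Sum>l\<in>\<Lambda>. card {(a, b). a \<in> A \<and> b \<in> A \<and> a \<noteq> b \<and> reduce_mod d (a - b) \<in> L l})
           = (\<Sum>(a, b)\<in>{(a, b). a \<in> A \<and> b \<in> A \<and> a \<noteq> b}. weight d \<Lambda> L (a - b))"
proof -
  let ?D = "{(a, b). a \<in> A \<and> b \<in> A \<and> a \<noteq> b}"
  have fin: "finite ?D"
    by (rule finite_subset[of _ "A \<times> A"]) (use \<open>finite A\<close> in auto)
  have "(\<Sum>l\<in>\<Lambda>. card {p \<in> ?D. reduce_mod d (fst p - snd p) \<in> L l})
      = (\<Sum>p\<in>?D. card {l \<in> \<Lambda>. reduce_mod d (fst p - snd p) \<in> L l})"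
    by (rule sum_multicount_gen) (use assms fin in auto)
  moreover have "{p \<in> ?D. reduce_mod d (fst p - snd p) \<in> L l}
      = {(a, b). a \<in> A \<and> b \<in> A \<and> a \<noteq> b \<and> reduce_mod d (a - b) \<in> L l}" for l
    by auto
  ultimately show ?thesis
    by (simp add: weight_def case_prod_unfold)
qed

lemma sum_over_pairs_eq_sum_rep_count:
  fixes v :: "'y \<Rightarrow> real"
  assumes "finite A"
  shows "(\<Sum>(a, b)\<in>{(a, b). a \<in> A \<and> b \<in> A \<and> a \<noteq> b}. v (F (a - b)))
           = (\<Sum>y\<in>F ` (difference_set A - {0}). real (rep_count A F y) * v y)"
proof -
  let ?D = "{(a, b). a \<in> A \<and> b \<in> A \<and> a \<noteq> b}"
  let ?f = "\<lambda>p. F (fst p - snd p)"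
  have fin: "finite ?D"
    by (rule finite_subset[of _ "A \<times> A"]) (use \<open>finite A\<close> in auto)
  have "(\<lambda>p. fst p - snd p) ` ?D = difference_set A - {0}"
    by (force simp: difference_set_def image_iff)
  then have img: "?f ` ?D = F ` (difference_set A - {0})"
    by (metis (no_types) image_image)
  have fibre: "{p \<in> ?D. ?f p = y} = {(a, b). a \<in> A \<and> b \<in> A \<and> a \<noteq> b \<and> F (a - b) = y}" for y
    by auto
  have "(\<Sum>p\<in>?D. v (?f p)) = (\<Sum>y\<in>?f ` ?D. \<Sum>p\<in>{p \<in> ?D. ?f p = y}. v (?f p))"
    by (rule sum.image_gen[OF fin])
  also have "\<dots> = (\<Sum>y\<in>?f ` ?D. real (card {p \<in> ?D. ?f p = y}) * v y)"
    by (intro sum.cong refl) simp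
  finally show ?thesis
    unfolding img fibre rep_count_def by (simp add: case_prod_unfold)
qed

theorem lemma2p1:
  fixes N d :: nat
    and A :: "(int ^ 'r::finite) set"
    and \<Lambda> :: "'l set"
    and L :: "'l \<Rightarrow> ('r \<Rightarrow> int) set"
    and M B :: real
    and Y :: "'y set"
    and F :: "int ^ 'r \<Rightarrow> 'y"
    and v :: "'y \<Rightarrow> real"
  assumes "N \<ge> 1"
    and "A \<subseteq> int_cube N"
    and "d \<ge> 1"
    and "finite \<Lambda>" and "\<Lambda> \<noteq> {}"
    and "\<And>l. l \<in> \<Lambda> \<Longrightarrow> subgroup (L l) (residue_vec_group d)"
    and "\<And>l. l \<in> \<Lambda> \<Longrightarrow> real (card (cosets_met d (L l) A)) \<le> M"
    and "F \<in> (UNIV - {0}) \<rightarrow> Y"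
    and "\<And>y. y \<in> Y \<Longrightarrow> real (rep_count A F y) \<le> B"
    and "\<And>y. y \<in> Y \<Longrightarrow> v y \<ge> 0"
    and "\<And>h. h \<in> difference_set A \<Longrightarrow> h \<noteq> 0 \<Longrightarrow> real (weight d \<Lambda> L h) \<le> v (F h)"
    and "real (card A) \<ge> 2 * M"
  shows "(real (card A))\<^sup>2
           \<le> 2 * M * B * (\<Sum>y \<in> F ` (difference_set A - {0}). v y) / real (card \<Lambda>)"
proof -
  let ?D = "{(a, b). a \<in> A \<and> b \<in> A \<and> a \<noteq> b}"
  let ?R = "\<lambda>l. {(a, b). a \<in> A \<and> b \<in> A \<and> a \<noteq> b \<and> reduce_mod d (a - b) \<in> L l}"
  let ?S = "F ` (difference_set A - {0})"
  note \<Lambda> = \<open>finite \<Lambda>\<close> \<open>\<Lambda> \<noteq> {}\<close>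
    and sub = assms(6) and few = assms(7) and FY = assms(8) and rep = assms(9)
    and v_nonneg = assms(10) and weight_le = assms(11) and large = assms(12)
  have finA: "finite A"
    by (rule finite_subset[OF assms(2) finite_int_cube])
  obtain l\<^sub>0 where "l\<^sub>0 \<in> \<Lambda>"
    using \<Lambda> by blast
  then have "0 \<le> M"
    using few[of l\<^sub>0] by linarith
  have "real (card \<Lambda>) * (real (card A))\<^sup>2 = (\<Sum>l\<in>\<Lambda>. (real (card A))\<^sup>2)"
    by simp
  also have "\<dots> \<le> (\<Sum>l\<in>\<Lambda>. 2 * M * real (card (?R l)))"
    by (intro sum_mono card_squared_le_off_diagonal_coset_pairs finA \<open>d \<ge> 1\<close> sub few large)
  also have "\<dots> = 2 * M * real (\<Sum>l\<in>\<Lambda>. card (?R l))"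
    by (simp add: sum_distrib_left)
  also have "\<dots> = 2 * M * (\<Sum>(a, b)\<in>?D. real (weight d \<Lambda> L (a - b)))"
    unfolding sum_card_coset_pairs_eq_sum_weight[OF finA \<open>finite \<Lambda>\<close>]
    by (simp add: case_prod_unfold)
  also have "\<dots> \<le> 2 * M * (\<Sum>(a, b)\<in>?D. v (F (a - b)))"
    using \<open>0 \<le> M\<close>
    by (intro mult_left_mono sum_mono) (auto intro!: weight_le difference_in_difference_set)
  also have "\<dots> = 2 * M * (\<Sum>y\<in>?S. real (rep_count A F y) * v y)"
    by (simp only: sum_over_pairs_eq_sum_rep_count[OF finA])
  also have "\<dots> \<le> 2 * M * (\<Sum>y\<in>?S. B * v y)"
    using \<open>0 \<le> M\<close> FY
    by (intro mult_left_mono sum_mono mult_right_mono rep v_nonneg) auto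
  also have "\<dots> = 2 * M * B * (\<Sum>y\<in>?S. v y)"
    by (simp add: sum_distrib_left mult.assoc)
  finally show ?thesis
    using \<Lambda> by (simp add: pos_le_divide_eq card_gt_0_iff mult.commute)
qed

end
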